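(* Let $a,b,c,d,e,f$ be nonnegative real numbers with $a+b+c+d+e+f=1$, and put $$A=cd(b+e)(a+f)+be(c+d)(a+f)+af(c+d)(b+e),$$ $$C=cd(a+b+e+f)+af(b+c+d+e)+be(a+c+d+f)+abd+ace+bcf+def.$$ Assume $C\neq 0$. Then $$15\,C-64\,A-224\,(abef+acdf+bcde)\ \ge\ 0,$$ $$3\,C-16\,A-32\,(abef+acdf+bcde)\ \ge\ 0,$$ and in each of the two inequalities equality holds if and only if $a=b=c=d=e=f=\frac16$. *)

theory Defs
  imports Complex_Main
begin

end

theory Submission
  imports Defs
begin

text \<open>
  Read a, ..., f as weights on the edges of the complete graph on four vertices, with opposite
  (disjoint) edges a|f, b|e, c|d. Then C sums the weights of the 16 spanning trees, A those of
  the 12 triangles with a pendant edge, and B = abef + acdf + bcde those of the three 4-cycles.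
  Write s for the sum of the weights. Both inequalities are combinations of two others: with
  \<^emph>\<open>G = s C - 4 A - 16 B\<close> and \<^emph>\<open>S = 2 s C - 12 A - 16 B\<close>, the left-hand sides, made homogeneous by
  multiplying C with s, are 13 G + S and G + S.

  Put resistances a, ..., f on the edges, each on the edge opposite to its own. The sum of the six
  effective resistances between vertices is then (3 A + 4 B) / C. It is a concave function of the
  resistances, homogeneous of degree 1 and invariant under the symmetries of the tetrahedron,
  which act transitively on the edges; so it is at most s/2, its value at equal resistances. This
  says S \<ge> 0; moreover, S is an explicit sum of squares with nonnegative coefficients
  (\<open>resistance_gap_eq\<close>). Its zeros with C \<noteq> 0 have equal weights (\<open>triangle_part_eq_0D\<close>).

  The function G has further zeros, for instance at a 4-cycle with equal weights. Fix the
  sums x, y, z of the opposite pairs and let u, v, w in [-1, 1] be the relative differences within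
  the pairs. These enter G only through P = 1 - u^2, Q = 1 - v^2, R = 1 - w^2, as a multi-affine
  function, and through one multiple of 1 + uvw, which \<open>one_plus_prod_ge\<close> bounds below
  by a linear function of P, Q, R. A multi-affine function is nonnegative on the unit cube once it is
  at the vertices, and there the claims are elementary inequalities in x, y, z
  (\<open>cycle_gap_nonneg\<close>).

  Equality in either of the two inequalities thus forces S = 0, hence equal weights.
\<close>

definition trees :: "real \<Rightarrow> real \<Rightarrow> real \<Rightarrow> real \<Rightarrow> real \<Rightarrow> real \<Rightarrow> real" where
  "trees a b c d e f = c*d*(a + b + e + f) + a*f*(b + c + d + e) + b*e*(a + c + d + f)
                   + a*b*d + a*c*e + b*c*f + d*e*f"

definition paws :: "real \<Rightarrow> real \<Rightarrow> real \<Rightarrow> real \<Rightarrow> real \<Rightarrow> real \<Rightarrow> real" where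
  "paws a b c d e f = c*d*(b + e)*(a + f) + b*e*(c + d)*(a + f) + a*f*(c + d)*(b + e)"

definition cycles :: "real \<Rightarrow> real \<Rightarrow> real \<Rightarrow> real \<Rightarrow> real \<Rightarrow> real \<Rightarrow> real" where
  "cycles a b c d e f = a*b*e*f + a*c*d*f + b*c*d*e"

section \<open>The sum of squares\<close>

definition spread :: "real \<Rightarrow> real \<Rightarrow> real \<Rightarrow> real" where
  "spread p q r = (p - q)^2 + (q - r)^2 + (p - r)^2"

lemma spread_nonneg: "spread p q r \<ge> 0"
  by (simp add: spread_def)

lemma spread_eq_0_iff: "spread p q r = 0 \<longleftrightarrow> p = q \<and> q = r"
proof
  assume "spread p q r = 0"
  then have "(p - q)^2 = 0 \<and> (q - r)^2 = 0"
    unfolding spread_def by (smt (verit) zero_le_power2)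
  then show "p = q \<and> q = r" by simp
qed (simp add: spread_def)

definition triangle_part :: "real \<Rightarrow> real \<Rightarrow> real \<Rightarrow> real \<Rightarrow> real \<Rightarrow> real \<Rightarrow> real" where
  "triangle_part a b c d e f =
     (a*b + b*c + c*a) * spread d e f + (a*d + d*e + e*a) * spread b c f
   + (b*d + d*f + f*b) * spread a c e + (c*e + e*f + f*c) * spread a b d"

definition opposite_part :: "real \<Rightarrow> real \<Rightarrow> real \<Rightarrow> real \<Rightarrow> real \<Rightarrow> real \<Rightarrow> real" where
  "opposite_part a b c d e f =
     a*f * ((b - e)^2 + (c - d)^2 + (b + e - c - d)^2)
   + b*e * ((a - f)^2 + (c - d)^2 + (a + f - c - d)^2)
   + c*d * ((a - f)^2 + (b - e)^2 + (a + f - b - e)^2)"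

text \<open>
  The triangles are abc, ade, bdf, cef. A square whose multiplier is a product of two edges may
  only involve the edges that complete this pair to a spanning tree: for two edges of a triangle
  these are the three edges outside the triangle, for two opposite edges they are the other four.
  (Any other square has a monomial that does not occur in s C.) The forms then follow from the
  symmetries, from vanishing at equal weights and from the coefficients on the left-hand side.
\<close>

lemma resistance_gap_eq:
  "2 * (a + b + c + d + e + f) * trees a b c d e f - 12 * paws a b c d e f - 16 * cycles a b c d e f
     = triangle_part a b c d e f + opposite_part a b c d e f"
  unfolding trees_def paws_def cycles_def triangle_part_def opposite_part_def spread_def
  by algebra

lemma triangle_part_nonneg:
  assumes "a \<ge> 0" "b \<ge> 0" "c \<ge> 0" "d \<ge> 0" "e \<ge> 0" "f \<ge> 0"
  shows "triangle_part a b c d e f \<ge> 0"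
  unfolding triangle_part_def using assms
  by (intro add_nonneg_nonneg mult_nonneg_nonneg spread_nonneg)

lemma opposite_part_nonneg:
  assumes "a \<ge> 0" "b \<ge> 0" "c \<ge> 0" "d \<ge> 0" "e \<ge> 0" "f \<ge> 0"
  shows "opposite_part a b c d e f \<ge> 0"
  unfolding opposite_part_def using assms
  by (intro add_nonneg_nonneg mult_nonneg_nonneg zero_le_power2)

text \<open>
  A spanning tree contains two adjacent edges, and these lie in a triangle. If both have positive
  weight, then the three edges outside this triangle have equal weights. These are positive since
  otherwise no spanning tree would have positive weight; now the other triangles have two edges of
  positive weight as well.
\<close>

lemma triangle_part_eq_0D:
  assumes nn: "a \<ge> 0" "b \<ge> 0" "c \<ge> 0" "d \<ge> 0" "e \<ge> 0" "f \<ge> 0"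
    and zero: "triangle_part a b c d e f = 0"
    and tree: "trees a b c d e f \<noteq> 0"
  shows "a = b \<and> b = c \<and> c = d \<and> d = e \<and> e = f"
proof -
  have nonneg: "(a*b + b*c + c*a) * spread d e f \<ge> 0" "(a*d + d*e + e*a) * spread b c f \<ge> 0"
    "(b*d + d*f + f*b) * spread a c e \<ge> 0" "(c*e + e*f + f*c) * spread a b d \<ge> 0"
    using nn by (intro mult_nonneg_nonneg add_nonneg_nonneg spread_nonneg; simp)+
  have "(a*b + b*c + c*a) * spread d e f = 0" "(a*d + d*e + e*a) * spread b c f = 0"
    "(b*d + d*f + f*b) * spread a c e = 0" "(c*e + e*f + f*c) * spread a b d = 0"
    using nonneg zero unfolding triangle_part_def by linarith+
  then have abc: "a*b + b*c + c*a = 0 \<or> d = e \<and> e = f"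
    and ade: "a*d + d*e + e*a = 0 \<or> b = c \<and> c = f"
    and bdf: "b*d + d*f + f*b = 0 \<or> a = c \<and> c = e"
    and cef: "c*e + e*f + f*c = 0 \<or> a = b \<and> b = d"
    by (auto simp: spread_eq_0_iff)
  have pos: "p*q + q*r + r*p \<noteq> 0" if "p \<ge> 0" "q > 0" "r > 0" for p q r :: real
    using that by (smt (verit) mult_nonneg_nonneg mult_pos_pos)
  have sum0: "p*q + q*r + r*p = 0 \<longleftrightarrow> p*q = 0 \<and> q*r = 0 \<and> r*p = 0"
    if "p \<ge> 0" "q \<ge> 0" "r \<ge> 0" for p q r :: real
    using that by (simp add: add_nonneg_eq_0_iff)
  consider "a*b + b*c + c*a \<noteq> 0" | "a*d + d*e + e*a \<noteq> 0" | "b*d + d*f + f*b \<noteq> 0"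
    | "c*e + e*f + f*c \<noteq> 0"
  proof (rule ccontr)
    assume "\<not> thesis"
    with that have "a*b + b*c + c*a = 0" "a*d + d*e + e*a = 0" "b*d + d*f + f*b = 0"
      "c*e + e*f + f*c = 0" by blast+
    then have "a*b = 0" "b*c = 0" "c*a = 0" "a*d = 0" "d*e = 0" "e*a = 0"
      "b*d = 0" "d*f = 0" "f*b = 0" "c*e = 0" "e*f = 0" "f*c = 0"
      using nn by (simp_all add: sum0)
    then have "trees a b c d e f = 0" unfolding trees_def by algebra
    with tree show False ..
  qed
  then show ?thesis
  proof cases
    case 1
    with abc have "d = e" "e = f" by auto
    moreover from this have "d \<noteq> 0" using tree by (auto simp: trees_def)
    ultimately have "d > 0" "e > 0" "f > 0" using nn by auto
    then have "b = c \<and> c = f" "a = c \<and> c = e"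
      using ade bdf pos[of a d e] pos[of b d f] nn by blast+
    with \<open>d = e\<close> \<open>e = f\<close> show ?thesis by simp
  next
    case 2
    with ade have "b = c" "c = f" by auto
    moreover from this have "b \<noteq> 0" using tree by (auto simp: trees_def)
    ultimately have "b > 0" "c > 0" "f > 0" using nn by auto
    then have "d = e \<and> e = f" "a = c \<and> c = e"
      using abc bdf pos[of a b c] pos[of d f b] nn by (simp_all add: ac_simps)
    with \<open>b = c\<close> \<open>c = f\<close> show ?thesis by simp
  next
    case 3
    with bdf have "a = c" "c = e" by auto
    moreover from this have "a \<noteq> 0" using tree by (auto simp: trees_def)
    ultimately have "a > 0" "c > 0" "e > 0" using nn by auto
    then have "d = e \<and> e = f" "b = c \<and> c = f"
      using abc ade pos[of b c a] pos[of d e a] nn by (simp_all add: ac_simps)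
    with \<open>a = c\<close> \<open>c = e\<close> show ?thesis by simp
  next
    case 4
    with cef have "a = b" "b = d" by auto
    moreover from this have "a \<noteq> 0" using tree by (auto simp: trees_def)
    ultimately have "a > 0" "b > 0" "d > 0" using nn by auto
    then have "d = e \<and> e = f" "b = c \<and> c = f"
      using abc ade pos[of c a b] pos[of e a d] nn by (simp_all add: ac_simps)
    with \<open>a = b\<close> \<open>b = d\<close> show ?thesis by simp
  qed
qed

section \<open>The inequality that is sharp at 4-cycles\<close>

lemma multiaffine_cube_nonneg:
  fixes P Q R :: real
  assumes P: "0 \<le> P" "P \<le> 1" and Q: "0 \<le> Q" "Q \<le> 1" and R: "0 \<le> R" "R \<le> 1"
    and one: "l \<ge> 0" "m \<ge> 0" "n \<ge> 0"
    and two: "l + m - i \<ge> 0" "l + n - j \<ge> 0" "m + n - k \<ge> 0"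
    and three: "l + m + n - i - j - k \<ge> 0"
  shows "P*l + Q*m + R*n - P*Q*i - P*R*j - Q*R*k \<ge> 0"
proof -
  have "P*l + Q*m + R*n - P*Q*i - P*R*j - Q*R*k =
      P*(1-Q)*(1-R)*l + (1-P)*Q*(1-R)*m + (1-P)*(1-Q)*R*n
    + P*Q*(1-R)*(l+m-i) + P*(1-Q)*R*(l+n-j) + (1-P)*Q*R*(m+n-k)
    + P*Q*R*(l+m+n-i-j-k)"
    by algebra
  also have "\<dots> \<ge> 0"
    using assms by (intro add_nonneg_nonneg mult_nonneg_nonneg) auto
  finally show ?thesis .
qed

text \<open>
  For numbers in [0, 1], the product pqr is at most its power with exponent 2/3, hence at most
  the mean of the squares; the proof averages the bounds of \<bar>uvw\<bar> by the products of two factors.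
  At u, v, w = \<plusminus>1 with uvw = -1 the function G is zero, and there the bound is exact.
\<close>

lemma one_plus_prod_ge:
  fixes u v w :: real
  assumes "\<bar>u\<bar> \<le> 1" "\<bar>v\<bar> \<le> 1" "\<bar>w\<bar> \<le> 1"
  shows "3 * (1 + u*v*w) \<ge> (1 - u^2) + (1 - v^2) + (1 - w^2)"
proof -
  have *: "\<bar>u*v*w\<bar> \<le> (p^2 + q^2) / 2"
    if "\<bar>u*v*w\<bar> = \<bar>r\<bar> * \<bar>p*q\<bar>" "\<bar>r\<bar> \<le> 1" for p q r :: real
  proof -
    have "\<bar>r\<bar> * \<bar>p*q\<bar> \<le> 1 * \<bar>p*q\<bar>" using that by (intro mult_right_mono) auto
    moreover have "2 * (\<bar>p\<bar> * \<bar>q\<bar>) \<le> p^2 + q^2"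
      using zero_le_power2[of "\<bar>p\<bar> - \<bar>q\<bar>"] by (simp add: power2_diff)
    ultimately show ?thesis using that by (simp add: abs_mult)
  qed
  have "\<bar>u*v*w\<bar> \<le> (v^2 + w^2) / 2" "\<bar>u*v*w\<bar> \<le> (u^2 + w^2) / 2" "\<bar>u*v*w\<bar> \<le> (u^2 + v^2) / 2"
    using *[of u v w] *[of v u w] *[of w u v] assms by (simp_all add: abs_mult mult_ac)
  then have "3 * \<bar>u*v*w\<bar> \<le> u^2 + v^2 + w^2" by (simp add: field_simps)
  moreover have "- \<bar>u*v*w\<bar> \<le> u*v*w" by (simp add: abs_le_iff)
  ultimately show ?thesis by (simp add: algebra_simps)
qed

text \<open>
  This is the coefficient of P in the multi-affine minorant of 4 G; those of Q and R are its
  permutations. The factor 2/3 comes from the bound on uvw, spread evenly over the three pairs.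
\<close>

definition pair_coeff :: "real \<Rightarrow> real \<Rightarrow> real \<Rightarrow> real" where
  "pair_coeff x y z = (x + y + z) * (x^2 * (y + z) + 2/3 * x*y*z) - 4 * x^2*y*z"

lemma pair_coeff_nonneg:
  assumes "x \<ge> 0" "y \<ge> 0" "z \<ge> 0"
  shows "pair_coeff x y z \<ge> 0"
proof -
  have "pair_coeff x y z =
      x * (x^2 * (y + z) + x * ((y - z)^2 + 2/3 * (y*z)) + 2/3 * (y*z*(y + z)))"
    unfolding pair_coeff_def by (simp add: field_simps power2_eq_square)
  also have "\<dots> \<ge> 0" using assms by simp
  finally show ?thesis .
qed

lemma pair_coeff_two_nonneg:
  assumes "x \<ge> 0" "y \<ge> 0" "z \<ge> 0"
  shows "pair_coeff x y z + pair_coeff y x z - 4 * x^2*y^2 \<ge> 0"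
proof -
  have "pair_coeff x y z + pair_coeff y x z - 4 * x^2*y^2 =
      x*y*(x - y)^2 + z * (x + y) * ((x - y)^2 + 1/3 * (x*y))
      + z^2 * (x^2 + y^2 + 4/3 * (x*y))"
    unfolding pair_coeff_def by (simp add: field_simps power2_eq_square)
  also have "\<dots> \<ge> 0" using assms by simp
  finally show ?thesis .
qed

lemma pair_coeff_three_nonneg:
  assumes "x \<ge> 0" "y \<ge> 0" "z \<ge> 0"
  shows "pair_coeff x y z + pair_coeff y x z + pair_coeff z x y
    - 4 * x^2*y^2 - 4 * x^2*z^2 - 4 * y^2*z^2 \<ge> 0"
proof -
  have "pair_coeff x y z + pair_coeff y x z + pair_coeff z x y
      - 4 * x^2*y^2 - 4 * x^2*z^2 - 4 * y^2*z^2
    = x*y*(x - y)^2 + x*z*(x - z)^2 + y*z*(y - z)^2"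
    unfolding pair_coeff_def by (simp add: field_simps power2_eq_square)
  also have "\<dots> \<ge> 0" using assms by simp
  finally show ?thesis .
qed

lemma cycle_gap_nonneg_param:
  fixes x y z u v w :: real
  assumes x: "x \<ge> 0" and y: "y \<ge> 0" and z: "z \<ge> 0"
    and u: "\<bar>u\<bar> \<le> 1" and v: "\<bar>v\<bar> \<le> 1" and w: "\<bar>w\<bar> \<le> 1"
    and ab: "a = x*(1+u)/2" "b = y*(1+v)/2" and cd: "c = z*(1-w)/2" "d = z*(1+w)/2"
    and ef: "e = y*(1-v)/2" "f = x*(1-u)/2"
  shows "(a + b + c + d + e + f) * trees a b c d e f - 4 * paws a b c d e f
    - 16 * cycles a b c d e f \<ge> 0" (is "?G \<ge> 0")
proof -
  define P Q R where PQR: "P = 1 - u^2" "Q = 1 - v^2" "R = 1 - w^2"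
  have sums: "a + f = x" "b + e = y" "c + d = z"
    and prods: "a*f = x^2*P/4" "b*e = y^2*Q/4" "c*d = z^2*R/4"
    unfolding ab cd ef PQR by (simp_all add: field_simps power2_eq_square)
  have cross: "a*b*d + a*c*e + b*c*f + d*e*f = x*y*z*(1 + u*v*w)/2"
    unfolding ab cd ef by (simp add: field_simps)
  have s: "a + b + c + d + e + f = x + y + z"
    using sums by linarith
  have "trees a b c d e f
      = c*d * ((a+f) + (b+e)) + a*f * ((b+e) + (c+d)) + b*e * ((a+f) + (c+d))
        + (a*b*d + a*c*e + b*c*f + d*e*f)"
    unfolding trees_def by algebra
  also have "\<dots> = z^2*R/4 * (x + y) + x^2*P/4 * (y + z) + y^2*Q/4 * (x + z)
        + x*y*z*(1 + u*v*w)/2"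
    unfolding sums prods cross ..
  finally have C: "trees a b c d e f = \<dots>" .
  have "paws a b c d e f = c*d * (b+e) * (a+f) + b*e * (c+d) * (a+f) + a*f * (c+d) * (b+e)"
    unfolding paws_def ..
  also have "\<dots> = z^2*R/4 * y * x + y^2*Q/4 * z * x + x^2*P/4 * z * y"
    unfolding sums prods ..
  finally have A: "paws a b c d e f = \<dots>" .
  have "cycles a b c d e f = (a*f)*(b*e) + (a*f)*(c*d) + (b*e)*(c*d)"
    unfolding cycles_def by algebra
  also have "\<dots> = (x^2*P/4)*(y^2*Q/4) + (x^2*P/4)*(z^2*R/4) + (y^2*Q/4)*(z^2*R/4)"
    unfolding prods ..
  finally have B: "cycles a b c d e f = \<dots>" .
  have "4 * ?G =
      P * pair_coeff x y z + Q * pair_coeff y x z + R * pair_coeff z x y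
        - P*Q*(4*x^2*y^2) - P*R*(4*x^2*z^2) - Q*R*(4*y^2*z^2)
        + (x + y + z) * (x*y*z) * (2/3) * (3 * (1 + u*v*w) - (P + Q + R))"
    unfolding s C A B pair_coeff_def by (simp add: field_simps power2_eq_square)
  moreover have "(x + y + z) * (x*y*z) * (2/3) * (3 * (1 + u*v*w) - (P + Q + R)) \<ge> 0"
    using x y z one_plus_prod_ge[OF u v w] unfolding PQR by (intro mult_nonneg_nonneg) auto
  moreover have "P * pair_coeff x y z + Q * pair_coeff y x z + R * pair_coeff z x y
        - P*Q*(4*x^2*y^2) - P*R*(4*x^2*z^2) - Q*R*(4*y^2*z^2) \<ge> 0"
  proof (rule multiaffine_cube_nonneg)
    show "0 \<le> P" "P \<le> 1" "0 \<le> Q" "Q \<le> 1" "0 \<le> R" "R \<le> 1"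
      unfolding PQR using u v w by (simp_all add: abs_square_le_1)
    show "pair_coeff x y z + pair_coeff z x y - 4*x^2*z^2 \<ge> 0"
      using pair_coeff_two_nonneg[OF x z y] by (simp add: pair_coeff_def algebra_simps)
    show "pair_coeff y x z + pair_coeff z x y - 4*y^2*z^2 \<ge> 0"
      using pair_coeff_two_nonneg[OF y z x] by (simp add: pair_coeff_def algebra_simps)
  qed (use pair_coeff_nonneg[OF x y z] pair_coeff_nonneg[OF y x z] pair_coeff_nonneg[OF z x y]
        pair_coeff_two_nonneg[OF x y z] pair_coeff_three_nonneg[OF x y z] in simp_all)
  ultimately have "4 * ?G \<ge> 0" by (simp only: add_nonneg_nonneg)
  then show ?thesis by (simp only: zero_le_mult_iff) simp
qed

lemma sum_difference_param:
  fixes p q :: real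
  assumes "p \<ge> 0" "q \<ge> 0"
  obtains t where "\<bar>t\<bar> \<le> 1" "p = (p + q) * (1 + t) / 2" "q = (p + q) * (1 - t) / 2"
proof
  \<comment> \<open>If both numbers are zero, the quotient is 0 by convention and the claims still hold.\<close>
  let ?t = "(p - q) / (p + q)"
  show "\<bar>?t\<bar> \<le> 1" using assms
    by (cases "p + q = 0") (simp_all add: abs_divide)
  have "(p + q) * ?t = p - q" using assms by (cases "p + q = 0") auto
  then show "p = (p + q) * (1 + ?t) / 2" "q = (p + q) * (1 - ?t) / 2"
    by (simp_all add: distrib_left right_diff_distrib)
qed

lemma cycle_gap_nonneg:
  assumes "a \<ge> 0" "b \<ge> 0" "c \<ge> 0" "d \<ge> 0" "e \<ge> 0" "f \<ge> 0"
  shows "(a + b + c + d + e + f) * trees a b c d e f - 4 * paws a b c d e f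
    - 16 * cycles a b c d e f \<ge> 0"
proof -
  obtain u where u: "\<bar>u\<bar> \<le> 1" "a = (a + f) * (1 + u) / 2" "f = (a + f) * (1 - u) / 2"
    using sum_difference_param assms(1,6) by blast
  obtain v where v: "\<bar>v\<bar> \<le> 1" "b = (b + e) * (1 + v) / 2" "e = (b + e) * (1 - v) / 2"
    using sum_difference_param assms(2,5) by blast
  obtain w where w: "\<bar>w\<bar> \<le> 1" "d = (d + c) * (1 + w) / 2" "c = (d + c) * (1 - w) / 2"
    using sum_difference_param assms(4,3) by blast
  have "a + f \<ge> 0" "b + e \<ge> 0" "d + c \<ge> 0" using assms by auto
  from cycle_gap_nonneg_param[OF this u(1) v(1) w(1) u(2) v(2) w(3) w(2) v(3) u(3)]
  show ?thesis .
qed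

section \<open>Combining the two inequalities\<close>

theorem mainTheorem4:
  fixes a b c d e f A C :: real
  assumes nonneg: "a \<ge> 0" "b \<ge> 0" "c \<ge> 0" "d \<ge> 0" "e \<ge> 0" "f \<ge> 0"
    and sum1: "a + b + c + d + e + f = 1"
    and A_eq: "A = c*d*(b + e)*(a + f) + b*e*(c + d)*(a + f) + a*f*(c + d)*(b + e)"
    and C_eq: "C = c*d*(a + b + e + f) + a*f*(b + c + d + e) + b*e*(a + c + d + f)
                   + a*b*d + a*c*e + b*c*f + d*e*f"
    and C_nz: "C \<noteq> 0"
  shows "15*C - 64*A - 224*(a*b*e*f + a*c*d*f + b*c*d*e) \<ge> 0
    \<and> 3*C - 16*A - 32*(a*b*e*f + a*c*d*f + b*c*d*e) \<ge> 0
    \<and> (15*C - 64*A - 224*(a*b*e*f + a*c*d*f + b*c*d*e) = 0 \<longleftrightarrow>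
         a = 1/6 \<and> b = 1/6 \<and> c = 1/6 \<and> d = 1/6 \<and> e = 1/6 \<and> f = 1/6)
    \<and> (3*C - 16*A - 32*(a*b*e*f + a*c*d*f + b*c*d*e) = 0 \<longleftrightarrow>
         a = 1/6 \<and> b = 1/6 \<and> c = 1/6 \<and> d = 1/6 \<and> e = 1/6 \<and> f = 1/6)"
proof -
  define B where "B = a*b*e*f + a*c*d*f + b*c*d*e"
  define T U where "T = triangle_part a b c d e f" and "U = opposite_part a b c d e f"
  have defs: "trees a b c d e f = C" "paws a b c d e f = A" "cycles a b c d e f = B"
    unfolding trees_def paws_def cycles_def A_eq C_eq B_def by simp_all
  have G: "C - 4*A - 16*B \<ge> 0"
    using cycle_gap_nonneg[OF nonneg] unfolding defs sum1 by simp
  have S: "2*C - 12*A - 16*B = T + U"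
    using resistance_gap_eq[of a b c d e f] unfolding defs sum1 T_def U_def by simp
  have T: "T \<ge> 0" and U: "U \<ge> 0"
    unfolding T_def U_def using triangle_part_nonneg[OF nonneg] opposite_part_nonneg[OF nonneg] .
  define g where "g = C - 4*A - 16*B"
  have first: "15*C - 64*A - 224*B = 13 * g + (T + U)"
    and second: "3*C - 16*A - 32*B = g + (T + U)"
    unfolding S[symmetric] g_def by simp_all
  have g: "g \<ge> 0" using G unfolding g_def .
  have centre: "a = 1/6 \<and> b = 1/6 \<and> c = 1/6 \<and> d = 1/6 \<and> e = 1/6 \<and> f = 1/6" if "T = 0"
    using triangle_part_eq_0D[OF nonneg that[unfolded T_def]] C_nz sum1 unfolding defs by auto
  have at_centre: "15*C - 64*A - 224*B = 0" "3*C - 16*A - 32*B = 0"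
    if "a = 1/6 \<and> b = 1/6 \<and> c = 1/6 \<and> d = 1/6 \<and> e = 1/6 \<and> f = 1/6"
  proof -
    have sixth: "a = 1/6" "b = 1/6" "c = 1/6" "d = 1/6" "e = 1/6" "f = 1/6"
      using that by blast+
    have "C = 2/27" "A = 1/108" "B = 1/432"
      unfolding C_eq A_eq B_def sixth by simp_all
    then show "15*C - 64*A - 224*B = 0" "3*C - 16*A - 32*B = 0" by simp_all
  qed
  have "15*C - 64*A - 224*B \<ge> 0" "3*C - 16*A - 32*B \<ge> 0"
    unfolding first second using g T U by simp_all
  moreover have "T = 0" if "15*C - 64*A - 224*B = 0 \<or> 3*C - 16*A - 32*B = 0"
    using that g T U unfolding first second by (auto simp: add_nonneg_eq_0_iff)
  ultimately show ?thesis
    unfolding B_def[symmetric] using centre at_centre by blast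
qed

end
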